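(* Let $C$ be a class of formulas. Let $\mathcal{A}$ be an exact concept learning algorithm that can identify every $\varphi\in C$ in at most $s_1$ equivalence queries and $s_2$ membership queries. Then there exists a sound invariant inference algorithm (one that returns only correct inductive invariants) that can find an inductive invariant for every transition system, over $n$ Boolean variables, that admits an inductive invariant $I\in C$ that is forwards $k_1$-fenced and backwards $k_2$-fenced, using at most $s_1+1$ inductiveness checks, $n(s_1+s_2)$ $k_1$-BMC checks, and $n(s_1+s_2)$ $k_2$-BMC checks.
   Context: Transition systems. $\Sigma=\{p_1,\dots,p_n\}$ is a finite set of Boolean variables; a state is a valuation of $\Sigma$; a formula over $\Sigma$ is identified with the set of states satisfying it, and $\varphi\Longrightarrow\psi$ means that $\varphi\to\psi$ is valid. A transition system is a triple $(\mathit{Init},\delta,\mathit{Bad})$ with $\mathit{Init},\mathit{Bad}$ formulas over $\Sigma$ and $\delta$ a formula over $\Sigma\uplus\Sigma'$ ($\Sigma'$ a primed copy), describing pairs (pre-state, post-state). Standing assumptions: $\mathit{Init}\not\equiv\mathit{false}$, $\mathit{Bad}\not\equiv\mathit{true},\mathit{false}$, $\mathit{Init}\Longrightarrow\neg\mathit{Bad}$. An inductive invariant is a formula $I$ over $\Sigma$ with (i) $\mathit{Init}\Longrightarrow I$, (ii) $I\wedge\delta\Longrightarrow I'$, (iii) $I\Longrightarrow\neg\mathit{Bad}$, where $I'$ is $I$ with variables primed. $\delta^{\le k}(S)$ is the set of states reachable from some state in $S$ in at most $k$ steps of $\delta$; $(\delta^{-1})^{\le k}(\mathit{Bad})$ is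 the set of states from which some state of $\mathit{Bad}$ is reachable in at most $k$ steps. Two states are neighbors if they differ in exactly one variable. $\partial^+(I)=\{\sigma\models I : \sigma\text{ has a neighbor }\not\models I\}$ and $\partial^-(I)=\{\sigma\not\models I : \sigma \text{ has a neighbor } \models I\}$. An inductive invariant $I$ is forwards $k$-fenced if $\partial^+(I)\subseteq\delta^{\le k}(\mathit{Init})$, and backwards $k$-fenced if $\partial^-(I)\subseteq(\delta^{-1})^{\le k}(\mathit{Bad})$. Exact concept learning. A learner must identify an unknown target formula $\varphi$ (up to equivalence) by adaptively posing queries to a teacher: a membership query on a state $\sigma$, answered by whether $\sigma\models\varphi$; an equivalence query on a formula $\theta$, answered by "true" if $\theta\equiv\varphi$ and otherwise by some (arbitrary) state $\sigma$ on which $\theta$ and $\varphi$ differ. An invariant inference algorithm receives a transition system (and the bounds $k_1,k_2$) but not $I$; it may perform inductiveness checks (deciding whether a candidate is an inductive invariant, and obtaining a counterexample to one of (i)–(iii) if not; a counterexample to (ii) is a pair $(\sigma,\sigma')$) and $k$-BMC checks (deciding whether $\delta^{\le k}(\psi)\cap\mathit{Bad}=\emptyset$ or whether $\delta^{\le k}(\mathit{Init})\cap\psi=\emptyset$ for a given $\psi$), and either returns a formula or reports failure. *)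

theory Defs
  imports "HOL-Library.Multiset" "HOL-Library.Cardinality"
begin

text \<open>
  The Boolean variables are the elements of a finite type \<open>'v\<close>, so the number of variables
  is \<open>CARD('v)\<close>. Formulas are identified with their sets of models; a formula over the
  variables and their primed copies is a relation between pre-states and post-states.
\<close>

type_synonym 'v state = "'v \<Rightarrow> bool"
type_synonym 'v formula = "'v state set"

record 'v transition_system =
  Init :: "'v formula"
  Delta :: "('v state \<times> 'v state) set"
  Bad :: "'v formula"

definition standing_assumptions :: "'v transition_system \<Rightarrow> bool" where
  "standing_assumptions T \<longleftrightarrow>
     Init T \<noteq> {} \<and> Bad T \<noteq> UNIV \<and> Bad T \<noteq> {} \<and> Init T \<subseteq> - Bad T"

definition inductive_invariant :: "'v transition_system \<Rightarrow> 'v formula \<Rightarrow> bool" where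
  "inductive_invariant T I \<longleftrightarrow>
     Init T \<subseteq> I \<and>
     (\<forall>\<sigma> \<sigma>'. \<sigma> \<in> I \<and> (\<sigma>, \<sigma>') \<in> Delta T \<longrightarrow> \<sigma>' \<in> I) \<and>
     I \<subseteq> - Bad T"

definition reach_within :: "('v state \<times> 'v state) set \<Rightarrow> nat \<Rightarrow> 'v formula \<Rightarrow> 'v formula" where
  "reach_within R k S = (\<Union>i\<le>k. (R ^^ i) `` S)"

definition neighbors :: "'v state \<Rightarrow> 'v state \<Rightarrow> bool" where
  "neighbors \<sigma> \<tau> \<longleftrightarrow> (\<exists>!p. \<sigma> p \<noteq> \<tau> p)"

definition inner_boundary :: "'v formula \<Rightarrow> 'v formula" where
  "inner_boundary I = {\<sigma> \<in> I. \<exists>\<tau>. neighbors \<sigma> \<tau> \<and> \<tau> \<notin> I}"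

definition outer_boundary :: "'v formula \<Rightarrow> 'v formula" where
  "outer_boundary I = {\<sigma>. \<sigma> \<notin> I \<and> (\<exists>\<tau>. neighbors \<sigma> \<tau> \<and> \<tau> \<in> I)}"

definition forwards_fenced :: "'v transition_system \<Rightarrow> nat \<Rightarrow> 'v formula \<Rightarrow> bool" where
  "forwards_fenced T k I \<longleftrightarrow> inner_boundary I \<subseteq> reach_within (Delta T) k (Init T)"

definition backwards_fenced :: "'v transition_system \<Rightarrow> nat \<Rightarrow> 'v formula \<Rightarrow> bool" where
  "backwards_fenced T k I \<longleftrightarrow> outer_boundary I \<subseteq> reach_within ((Delta T)\<inverse>) k (Bad T)"

text \<open>
  A learner is an adaptive strategy: a tree branching on the teacher's answers. It is a
  codatatype because nothing is assumed about the learner on targets outside the class,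
  where it need not terminate. The answer \<open>None\<close> to an equivalence query means ``true''.
\<close>

codatatype 'v learner =
    Output "'v formula"
  | Membership "'v state" "bool \<Rightarrow> 'v learner"
  | Equivalence "'v formula" "'v state option \<Rightarrow> 'v learner"

fun equivalence_answer :: "'v formula \<Rightarrow> 'v formula \<Rightarrow> 'v state option \<Rightarrow> bool" where
  "equivalence_answer \<phi> \<theta> None \<longleftrightarrow> \<theta> = \<phi>"
| "equivalence_answer \<phi> \<theta> (Some \<sigma>) \<longleftrightarrow> (\<sigma> \<in> \<theta>) \<noteq> (\<sigma> \<in> \<phi>)"

text \<open>
  \<open>identifies \<phi> e m L\<close>: whatever correct answers a teacher for \<open>\<phi>\<close> gives, \<open>L\<close> stops with
  output \<open>\<phi>\<close> after at most \<open>e\<close> equivalence and \<open>m\<close> membership queries.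
\<close>

inductive identifies :: "'v formula \<Rightarrow> nat \<Rightarrow> nat \<Rightarrow> 'v learner \<Rightarrow> bool" for \<phi> where
  identifies_Output: "identifies \<phi> e m (Output \<phi>)"
| identifies_Membership:
    "identifies \<phi> e m (L (\<sigma> \<in> \<phi>)) \<Longrightarrow> identifies \<phi> e (Suc m) (Membership \<sigma> L)"
| identifies_Equivalence:
    "(\<And>a. equivalence_answer \<phi> \<theta> a \<Longrightarrow> identifies \<phi> e m (L a)) \<Longrightarrow>
     identifies \<phi> (Suc e) m (Equivalence \<theta> L)"

datatype 'v counterexample =
    CexInit "'v state"
  | CexStep "'v state" "'v state"
  | CexBad "'v state"

fun is_counterexample :: "'v transition_system \<Rightarrow> 'v formula \<Rightarrow> 'v counterexample \<Rightarrow> bool" where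
  "is_counterexample T \<theta> (CexInit \<sigma>) \<longleftrightarrow> \<sigma> \<in> Init T \<and> \<sigma> \<notin> \<theta>"
| "is_counterexample T \<theta> (CexStep \<sigma> \<sigma>') \<longleftrightarrow> \<sigma> \<in> \<theta> \<and> (\<sigma>, \<sigma>') \<in> Delta T \<and> \<sigma>' \<notin> \<theta>"
| "is_counterexample T \<theta> (CexBad \<sigma>) \<longleftrightarrow> \<sigma> \<in> \<theta> \<and> \<sigma> \<in> Bad T"

fun inductiveness_answer ::
  "'v transition_system \<Rightarrow> 'v formula \<Rightarrow> 'v counterexample option \<Rightarrow> bool" where
  "inductiveness_answer T \<theta> None \<longleftrightarrow> inductive_invariant T \<theta>"
| "inductiveness_answer T \<theta> (Some c) \<longleftrightarrow> is_counterexample T \<theta> c"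

text \<open>
  The interaction of an inference algorithm with the checks, as a tree branching on their
  results. It is a datatype, hence well-founded: the algorithm always stops, either
  returning a formula or reporting failure. \<open>BMCBad k \<psi>\<close> decides whether
  no bad state is reachable from \<open>\<psi>\<close> within \<open>k\<close> steps, \<open>BMCInit k \<psi>\<close> whether no state
  of \<open>\<psi>\<close> is reachable from an initial state within \<open>k\<close> steps.
\<close>

datatype 'v inference =
    Return "'v formula"
  | Failure
  | Inductive "'v formula" "'v counterexample option \<Rightarrow> 'v inference"
  | BMCBad nat "'v formula" "bool \<Rightarrow> 'v inference"
  | BMCInit nat "'v formula" "bool \<Rightarrow> 'v inference"

text \<open>
  The arguments are the initial states, the bad states and the bounds \<open>k\<^sub>1\<close>, \<open>k\<^sub>2\<close>. The
  transition relation is deliberately not an argument: it is accessible only through the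
  checks. Since algorithms are arbitrary functions here, one applied directly to the
  transition relation could name an inductive invariant without performing any check, and
  counting checks would be meaningless.
\<close>

type_synonym 'v inference_algorithm =
  "'v formula \<Rightarrow> 'v formula \<Rightarrow> nat \<Rightarrow> nat \<Rightarrow> 'v inference"

text \<open>
  \<open>run T t c b r\<close>: some execution of \<open>t\<close> on \<open>T\<close> performs \<open>c\<close> inductiveness checks and BMC
  checks whose bounds form the multiset \<open>b\<close>, and ends with outcome \<open>r\<close>, where \<open>None\<close> is
  failure. The counterexamples are chosen arbitrarily by the environment. Every check has an
  admissible answer and \<open>t\<close> is well-founded, so an execution always exists.
\<close>

inductive run ::
  "'v transition_system \<Rightarrow> 'v inference \<Rightarrow> nat \<Rightarrow> nat multiset \<Rightarrow> 'v formula option \<Rightarrow> bool"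
  for T where
  run_Return: "run T (Return \<theta>) 0 {#} (Some \<theta>)"
| run_Failure: "run T Failure 0 {#} None"
| run_Inductive:
    "inductiveness_answer T \<theta> a \<Longrightarrow> run T (f a) c b r \<Longrightarrow> run T (Inductive \<theta> f) (Suc c) b r"
| run_BMCBad:
    "run T (f (reach_within (Delta T) k \<psi> \<inter> Bad T = {})) c b r \<Longrightarrow>
     run T (BMCBad k \<psi> f) c (add_mset k b) r"
| run_BMCInit:
    "run T (f (reach_within (Delta T) k (Init T) \<inter> \<psi> = {})) c b r \<Longrightarrow>
     run T (BMCInit k \<psi> f) c (add_mset k b) r"

definition sound :: "'v inference_algorithm \<Rightarrow> bool" where
  "sound M \<longleftrightarrow>
     (\<forall>T k\<^sub>1 k\<^sub>2 c b \<theta>. standing_assumptions T \<and> run T (M (Init T) (Bad T) k\<^sub>1 k\<^sub>2) c b (Some \<theta>)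
        \<longrightarrow> inductive_invariant T \<theta>)"

text \<open>
  The last conjunct bounds the BMC checks: all of them have bound \<open>k\<^sub>1\<close> or \<open>k\<^sub>2\<close>, at most
  \<open>n\<^sub>1\<close> count as \<open>k\<^sub>1\<close>-BMC checks and at most \<open>n\<^sub>2\<close> as \<open>k\<^sub>2\<close>-BMC checks. The multiset sum
  makes this correct also for \<open>k\<^sub>1 = k\<^sub>2\<close>, where the allowances add up.
\<close>

definition finds_invariant ::
  "'v inference_algorithm \<Rightarrow> 'v transition_system \<Rightarrow> nat \<Rightarrow> nat \<Rightarrow> nat \<Rightarrow> nat \<Rightarrow> nat \<Rightarrow> bool" where
  "finds_invariant M T k\<^sub>1 k\<^sub>2 s n\<^sub>1 n\<^sub>2 \<longleftrightarrow>
     (\<forall>c b r. run T (M (Init T) (Bad T) k\<^sub>1 k\<^sub>2) c b r \<longrightarrow>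
        (\<exists>\<theta>. r = Some \<theta> \<and> inductive_invariant T \<theta>) \<and>
        c \<le> s \<and>
        b \<subseteq># replicate_mset n\<^sub>1 k\<^sub>1 + replicate_mset n\<^sub>2 k\<^sub>2)"

end

theory Submission
  imports Defs
begin

text \<open>
  The learner is run with \<open>I\<close> as its hidden target. To decide \<open>\<sigma> \<in> I\<close>, walk from \<open>\<sigma>\<close> to a fixed
  initial state, correcting one variable at a time, and stop at the first state that is reachable
  from \<open>Init\<close> within \<open>k\<^sub>1\<close> steps (then \<open>\<sigma> \<in> I\<close>) or reaches \<open>Bad\<close> within \<open>k\<^sub>2\<close> steps (then
  \<open>\<sigma> \<notin> I\<close>): states of the first kind lie in \<open>I\<close>, those of the second kind lie outside \<open>I\<close>, and by
  the two fence conditions the walk cannot cross the boundary of \<open>I\<close> without such a stop. An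
  equivalence query becomes an inductiveness check; a counterexample to induction
  \<open>(\<sigma>, \<sigma>')\<close> is turned into a differing state by one membership query on \<open>\<sigma>\<close>, since
  \<open>\<sigma> \<in> I\<close> implies \<open>\<sigma>' \<in> I\<close>.
\<close>

section \<open>Bounded reachability and inductive invariants\<close>

text \<open>Backwards fences are stated with the converse relation, whereas a \<open>BMCBad\<close>
  check on a single state looks forwards; this is the bridge between them.\<close>

lemma reach_within_converse_iff:
  "x \<in> reach_within (R\<inverse>) k B \<longleftrightarrow> reach_within R k {x} \<inter> B \<noteq> {}"
proof -
  have "R\<inverse> ^^ i = (R ^^ i)\<inverse>" for i
  proof (induction i)
    case (Suc i)
    then show ?case by (metis converse_relcomp relpow.simps(2) relpow_commute)
  qed simp
  then show ?thesis
    unfolding reach_within_def by auto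
qed

lemma inductive_invariant_relpow:
  assumes "inductive_invariant T I" "(x, y) \<in> Delta T ^^ i" "x \<in> I"
  shows "y \<in> I"
  using assms(2)
proof (induction i arbitrary: y)
  case 0
  with assms(3) show ?case by simp
next
  case (Suc i)
  from Suc.prems obtain z where "(x, z) \<in> Delta T ^^ i" "(z, y) \<in> Delta T"
    by (rule relpow_Suc_E)
  with Suc.IH assms(1) show ?case unfolding inductive_invariant_def by blast
qed

text \<open>Used with \<open>S = Init T\<close> and with a singleton: it makes the verdict at each
  stop of the walk correct, with no appeal to the fences.\<close>

lemma reach_within_subset_invariant:
  assumes "inductive_invariant T I" "S \<subseteq> I"
  shows "reach_within (Delta T) k S \<subseteq> I"
  unfolding reach_within_def using inductive_invariant_relpow[OF assms(1)] assms(2) by blast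

lemma reach_within_Init_subset:
  "inductive_invariant T I \<Longrightarrow> reach_within (Delta T) k (Init T) \<subseteq> I"
  by (rule reach_within_subset_invariant) (simp_all add: inductive_invariant_def)

lemma reach_within_disjoint_Bad:
  "inductive_invariant T I \<Longrightarrow> x \<in> I \<Longrightarrow> reach_within (Delta T) k {x} \<inter> Bad T = {}"
  using reach_within_subset_invariant[of T I "{x}" k]
  unfolding inductive_invariant_def by blast

lemma neighbors_fun_upd: "\<sigma> v \<noteq> b \<Longrightarrow> neighbors \<sigma> (\<sigma>(v := b))"
  unfolding neighbors_def by (rule ex1I[of _ v]) (auto split: if_splits)

inductive_cases run_ReturnE: "run T (Return \<theta>) c b r"
inductive_cases run_FailureE: "run T Failure c b r"
inductive_cases run_InductiveE: "run T (Inductive \<theta> f) c b r"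
inductive_cases run_BMCBadE: "run T (BMCBad k \<psi> f) c b r"
inductive_cases run_BMCInitE: "run T (BMCInit k \<psi> f) c b r"

section \<open>Membership queries answered by BMC checks\<close>

text \<open>
  \<open>K\<close> is a continuation: the rest of the interaction, given the answer to the membership query.
\<close>

primrec member_along ::
  "nat \<Rightarrow> nat \<Rightarrow> 'v state \<Rightarrow> 'v list \<Rightarrow> 'v state \<Rightarrow> (bool \<Rightarrow> 'v inference) \<Rightarrow> 'v inference" where
  "member_along k\<^sub>1 k\<^sub>2 \<tau> [] \<sigma> K = K True"
| "member_along k\<^sub>1 k\<^sub>2 \<tau> (v # vs) \<sigma> K =
     BMCInit k\<^sub>1 {\<sigma>} (\<lambda>unreachable. if \<not> unreachable then K True else
     BMCBad k\<^sub>2 {\<sigma>} (\<lambda>safe. if \<not> safe then K False else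
     member_along k\<^sub>1 k\<^sub>2 \<tau> vs (\<sigma>(v := \<tau> v)) K))"

text \<open>Without fences the walk may give a wrong answer, but it never ends the interaction
  itself and only hands control to \<open>K\<close>. Soundness needs no more than this.\<close>

lemma run_member_along:
  "run T (member_along k\<^sub>1 k\<^sub>2 \<tau> vs \<sigma> K) c b r \<Longrightarrow> \<exists>x c' b'. run T (K x) c' b' r"
proof (induction vs arbitrary: \<sigma> c b)
  case Nil
  then show ?case by auto
next
  case (Cons v vs)
  then show ?case
    by (force elim!: run_BMCInitE run_BMCBadE split: if_splits)
qed

text \<open>Induction on the variables still to be corrected: the walk ends in an initial state,
  hence in \<open>I\<close>, and each step costs at most one check of each bound. \<open>d\<close>
  collects the checks of the walk, \<open>b'\<close> those of the continuation.\<close>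

lemma run_member_along_fenced:
  assumes inv: "inductive_invariant T I"
    and fwd: "forwards_fenced T k\<^sub>1 I" and bwd: "backwards_fenced T k\<^sub>2 I"
    and \<tau>: "\<tau> \<in> Init T"
    and agree: "\<And>v. v \<notin> set vs \<Longrightarrow> \<sigma> v = \<tau> v"
    and run: "run T (member_along k\<^sub>1 k\<^sub>2 \<tau> vs \<sigma> K) c b r"
  shows "\<exists>b' d. run T (K (\<sigma> \<in> I)) c b' r \<and> b = b' + d \<and>
           d \<subseteq># replicate_mset (length vs) k\<^sub>1 + replicate_mset (length vs) k\<^sub>2"
  using agree run
proof (induction vs arbitrary: \<sigma> c b)
  case Nil
  then have "\<sigma> = \<tau>" by auto
  with inv \<tau> have "\<sigma> \<in> I" by (auto simp: inductive_invariant_def)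
  with Nil(2) show ?case by auto
next
  case (Cons v vs)
  let ?\<sigma>' = "\<sigma>(v := \<tau> v)"
  let ?R = "replicate_mset (length vs) k\<^sub>1 + replicate_mset (length vs) k\<^sub>2"
  have R: "replicate_mset (length (v # vs)) k\<^sub>1 + replicate_mset (length (v # vs)) k\<^sub>2
      = {#k\<^sub>1, k\<^sub>2#} + ?R"
    by simp
  from Cons.prems(2) obtain b1 where b: "b = add_mset k\<^sub>1 b1" and
    r1: "run T (if reach_within (Delta T) k\<^sub>1 (Init T) \<inter> {\<sigma>} \<noteq> {} then K True else
      BMCBad k\<^sub>2 {\<sigma>} (\<lambda>safe. if \<not> safe then K False else member_along k\<^sub>1 k\<^sub>2 \<tau> vs ?\<sigma>' K)) c b1 r"
    by (auto elim: run_BMCInitE)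
  show ?case
  proof (cases "\<sigma> \<in> reach_within (Delta T) k\<^sub>1 (Init T)")
    case True
    with reach_within_Init_subset[OF inv] have "\<sigma> \<in> I" by blast
    moreover have "run T (K True) c b1 r" using r1 True by simp
    ultimately show ?thesis
      unfolding R using b by (intro exI[of _ b1] exI[of _ "{#k\<^sub>1#}"]) auto
  next
    case not_reach: False
    with r1 obtain b2 where b1: "b1 = add_mset k\<^sub>2 b2" and
      r2: "run T (if reach_within (Delta T) k\<^sub>2 {\<sigma>} \<inter> Bad T \<noteq> {} then K False else
        member_along k\<^sub>1 k\<^sub>2 \<tau> vs ?\<sigma>' K) c b2 r"
      by (auto elim: run_BMCBadE)
    show ?thesis
    proof (cases "reach_within (Delta T) k\<^sub>2 {\<sigma>} \<inter> Bad T = {}")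
      case False
      with reach_within_disjoint_Bad[OF inv] have "\<sigma> \<notin> I" by blast
      moreover have "run T (K False) c b2 r" using r2 False by simp
      ultimately show ?thesis
        unfolding R using b b1 by (intro exI[of _ b2] exI[of _ "{#k\<^sub>1, k\<^sub>2#}"]) auto
    next
      case True
      \<comment> \<open>Neither check fired, so \<sigma> lies in neither boundary and its membership
        in \<open>I\<close> passes to the neighbor. If \<sigma> already agrees with \<tau> at
        \<open>v\<close>, the step leaves it unchanged.\<close>
      have mem: "?\<sigma>' \<in> I \<longleftrightarrow> \<sigma> \<in> I"
      proof (cases "\<sigma> v = \<tau> v")
        case True
        then have "?\<sigma>' = \<sigma>" by (rule fun_upd_idem)
        then show ?thesis by simp
      next
        case False
        then have "neighbors \<sigma> ?\<sigma>'" by (rule neighbors_fun_upd)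
        moreover have "\<sigma> \<notin> inner_boundary I"
          using not_reach fwd unfolding forwards_fenced_def by blast
        moreover have "\<sigma> \<notin> outer_boundary I"
          using True bwd reach_within_converse_iff[of \<sigma> "Delta T" k\<^sub>2 "Bad T"]
          unfolding backwards_fenced_def by blast
        ultimately show ?thesis
          unfolding inner_boundary_def outer_boundary_def by blast
      qed
      have run': "run T (member_along k\<^sub>1 k\<^sub>2 \<tau> vs ?\<sigma>' K) c b2 r"
        using r2 True by simp
      have agree': "\<And>w. w \<notin> set vs \<Longrightarrow> ?\<sigma>' w = \<tau> w"
        using Cons.prems(1) by auto
      from Cons.IH[OF agree' run'] obtain b' d where
        "run T (K (\<sigma> \<in> I)) c b' r" "b2 = b' + d" "d \<subseteq># ?R"
        unfolding mem by blast
      then show ?thesis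
        unfolding R using b b1
        by (intro exI[of _ b'] exI[of _ "{#k\<^sub>1, k\<^sub>2#} + d"]) (auto intro: subset_mset.add_mono)
    qed
  qed
qed

section \<open>Simulation of the learner\<close>

text \<open>
  \<open>Q\<close> simulates membership queries. The fuel argument makes the interaction
  well-founded although the learner need not terminate on targets outside its class.
\<close>

primrec infer ::
  "('v state \<Rightarrow> (bool \<Rightarrow> 'v inference) \<Rightarrow> 'v inference) \<Rightarrow> nat \<Rightarrow> 'v learner \<Rightarrow> 'v inference" where
  "infer Q 0 A = Failure"
| "infer Q (Suc N) A = (case A of
     Output \<theta> \<Rightarrow> Inductive \<theta> (\<lambda>a. if a = None then Return \<theta> else Failure)
   | Membership \<sigma> L \<Rightarrow> Q \<sigma> (\<lambda>x. infer Q N (L x))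
   | Equivalence \<theta> L \<Rightarrow> Inductive \<theta> (\<lambda>a. case a of
         None \<Rightarrow> Return \<theta>
       | Some (CexInit \<sigma>) \<Rightarrow> infer Q N (L (Some \<sigma>))
       | Some (CexStep \<sigma> \<sigma>') \<Rightarrow> Q \<sigma> (\<lambda>x. infer Q N (L (Some (if x then \<sigma>' else \<sigma>))))
       | Some (CexBad \<sigma>) \<Rightarrow> infer Q N (L (Some \<sigma>))))"

text \<open>A formula is returned only right after a successful inductiveness check on it, so wrong
  answers from \<open>Q\<close> cannot spoil soundness.\<close>

lemma run_infer_sound:
  assumes Q: "\<And>\<sigma> K c b r. run T (Q \<sigma> K) c b r \<Longrightarrow> \<exists>x c' b'. run T (K x) c' b' r"
    and "run T (infer Q N A) c b (Some \<theta>)"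
  shows "inductive_invariant T \<theta>"
  using assms(2)
proof (induction N arbitrary: A c b)
  case 0
  then show ?case by (auto elim: run_FailureE)
next
  case (Suc N)
  show ?case
  proof (cases A)
    case (Output \<theta>')
    with Suc.prems show ?thesis
      by (auto elim!: run_InductiveE run_ReturnE run_FailureE split: if_splits)
  next
    case (Membership \<sigma> L)
    with Suc.prems have "run T (Q \<sigma> (\<lambda>x. infer Q N (L x))) c b (Some \<theta>)" by simp
    from Q[OF this] show ?thesis using Suc.IH by blast
  next
    case (Equivalence \<theta>' L)
    with Suc.prems obtain a c' where
      a: "inductiveness_answer T \<theta>' a"
      and r: "run T (case a of
           None \<Rightarrow> Return \<theta>'
         | Some (CexInit \<sigma>) \<Rightarrow> infer Q N (L (Some \<sigma>))
         | Some (CexStep \<sigma> \<sigma>') \<Rightarrow> Q \<sigma> (\<lambda>x. infer Q N (L (Some (if x then \<sigma>' else \<sigma>))))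
         | Some (CexBad \<sigma>) \<Rightarrow> infer Q N (L (Some \<sigma>))) c' b (Some \<theta>)"
      by (auto elim: run_InductiveE)
    show ?thesis
    proof (cases a)
      case None
      with a r show ?thesis by (auto elim: run_ReturnE)
    next
      case (Some cex)
      with r show ?thesis
        by (cases cex) (auto dest: Q Suc.IH)
    qed
  qed
qed

text \<open>Each query of the learner triggers at most one call of \<open>Q\<close>, which gives the
  BMC budget; the additional inductiveness check tests the final output. The induction can follow
  \<open>identifies\<close> because that predicate covers every admissible counterexample.\<close>

lemma run_infer_identifies:
  fixes n k\<^sub>1 k\<^sub>2 :: nat
  defines "budget \<equiv> \<lambda>j. replicate_mset (n * j) k\<^sub>1 + replicate_mset (n * j) k\<^sub>2"
  assumes inv: "inductive_invariant T I"
    and Q: "\<And>\<sigma> K c b r. run T (Q \<sigma> K) c b r \<Longrightarrow>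
      \<exists>b' d. run T (K (\<sigma> \<in> I)) c b' r \<and> b = b' + d \<and> d \<subseteq># replicate_mset n k\<^sub>1 + replicate_mset n k\<^sub>2"
    and "identifies I e m A" and "e + m < N" and "run T (infer Q N A) c b r"
  shows "(\<exists>\<theta>. r = Some \<theta> \<and> inductive_invariant T \<theta>) \<and> c \<le> e + 1 \<and> b \<subseteq># budget (e + m)"
proof -
  have budget_Suc: "budget (Suc j) = budget j + budget 1" for j
    unfolding budget_def by (simp add: multiset_eq_iff algebra_simps)
  have budget_1: "budget 1 = replicate_mset n k\<^sub>1 + replicate_mset n k\<^sub>2"
    unfolding budget_def by simp
  \<comment> \<open>For \<open>CexInit\<close> and \<open>CexBad\<close> no call of \<open>Q\<close>
    is made, and the allowance of one query stays unspent.\<close>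
  have budget_le: "b' \<subseteq># budget (Suc j)" if "b' \<subseteq># budget j" for b' j
    unfolding budget_Suc using that by (simp add: subset_mset.add_increasing2)
  have budget_add: "b' + d \<subseteq># budget (Suc j)" if "b' \<subseteq># budget j" "d \<subseteq># budget 1" for b' d j
    unfolding budget_Suc using that by (rule subset_mset.add_mono)
  note Q = Q[folded budget_1]
  show ?thesis
    using assms(4-)
  proof (induction arbitrary: N c b rule: identifies.induct)
    case (identifies_Output e m)
    then obtain N' where [simp]: "N = Suc N'" using less_imp_Suc_add by blast
    from identifies_Output.prems(2) obtain a c' where
      a: "inductiveness_answer T I a" and c: "c = Suc c'"
      and r: "run T (if a = None then Return I else Failure) c' b r"
      by (auto elim: run_InductiveE)
    \<comment> \<open>The target is itself inductive, so its check admits no counterexample.\<close>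
    from a inv have "a = None"
      by (cases a rule: option.exhaust; cases "the a")
        (auto simp: inductive_invariant_def)
    with r have "c' = 0" "b = {#}" "r = Some I" by (auto elim: run_ReturnE)
    with inv c show ?case by simp
  next
    case (identifies_Membership e m L \<sigma>)
    from identifies_Membership.prems(1) obtain N' where [simp]: "N = Suc N'"
      using less_imp_Suc_add by blast
    from identifies_Membership.prems(2)
    have "run T (Q \<sigma> (\<lambda>x. infer Q N' (L x))) c b r" by simp
    from Q[OF this] obtain b' d where r: "run T (infer Q N' (L (\<sigma> \<in> I))) c b' r"
      and b: "b = b' + d" and d: "d \<subseteq># budget 1"
      by blast
    from identifies_Membership.IH[OF _ r] identifies_Membership.prems(1) d
    show ?case unfolding b by (auto intro: budget_add)
  next
    case (identifies_Equivalence \<theta> e m L)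
    from identifies_Equivalence.prems(1) obtain N' where N: "N = Suc N'"
      using less_imp_Suc_add by blast
    have IH: "(\<exists>\<theta>. r = Some \<theta> \<and> inductive_invariant T \<theta>) \<and> c \<le> e + 1 \<and> b \<subseteq># budget (e + m)"
      if "(\<sigma> \<in> \<theta>) \<noteq> (\<sigma> \<in> I)" "run T (infer Q N' (L (Some \<sigma>))) c b r" for \<sigma> c b
      using identifies_Equivalence.IH[of "Some \<sigma>" N' c b] identifies_Equivalence.prems(1) that N
      by simp
    from identifies_Equivalence.prems(2) obtain a c' where
      a: "inductiveness_answer T \<theta> a" and c: "c = Suc c'"
      and r: "run T (case a of
           None \<Rightarrow> Return \<theta>
         | Some (CexInit \<sigma>) \<Rightarrow> infer Q N' (L (Some \<sigma>))
         | Some (CexStep \<sigma> \<sigma>') \<Rightarrow> Q \<sigma> (\<lambda>x. infer Q N' (L (Some (if x then \<sigma>' else \<sigma>))))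
         | Some (CexBad \<sigma>) \<Rightarrow> infer Q N' (L (Some \<sigma>))) c' b r"
      unfolding N by (auto elim: run_InductiveE)
    show ?case
    proof (cases a)
      case None
      \<comment> \<open>\<theta> may differ from \<open>I\<close> here: any inductive invariant is
        acceptable, so the learner is abandoned.\<close>
      with r have "c' = 0" "b = {#}" "r = Some \<theta>" by (auto elim: run_ReturnE)
      with a None c show ?thesis by simp
    next
      case (Some cex)
      show ?thesis
      proof (cases cex)
        case (CexInit \<sigma>)
        with a Some inv have "(\<sigma> \<in> \<theta>) \<noteq> (\<sigma> \<in> I)" by (auto simp: inductive_invariant_def)
        from IH[OF this] r Some CexInit c show ?thesis by (auto intro: budget_le)
      next
        case (CexBad \<sigma>)
        with a Some inv have "(\<sigma> \<in> \<theta>) \<noteq> (\<sigma> \<in> I)" by (auto simp: inductive_invariant_def)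
        from IH[OF this] r Some CexBad c show ?thesis by (auto intro: budget_le)
      next
        case (CexStep \<sigma> \<sigma>')
        \<comment> \<open>If \<sigma> is in \<open>I\<close>, so is \<sigma>', which is outside
          \<theta>; otherwise \<sigma> is in \<theta> but not in \<open>I\<close>.\<close>
        let ?\<rho> = "if \<sigma> \<in> I then \<sigma>' else \<sigma>"
        from CexStep a Some inv have differ: "(?\<rho> \<in> \<theta>) \<noteq> (?\<rho> \<in> I)"
          by (auto simp: inductive_invariant_def)
        from r Some CexStep
        have "run T (Q \<sigma> (\<lambda>x. infer Q N' (L (Some (if x then \<sigma>' else \<sigma>))))) c' b r" by simp
        from Q[OF this] obtain b' d where r': "run T (infer Q N' (L (Some ?\<rho>))) c' b' r"
          and b: "b = b' + d" and d: "d \<subseteq># budget 1"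
          by blast
        from IH[OF differ r'] d c show ?thesis
          unfolding b by (auto intro: budget_add)
      qed
    qed
  qed
qed

section \<open>The inference algorithm and its bounds\<close>

theorem corollary7p7:
  fixes C :: "('v::finite) formula set"
    and A :: "'v learner"
    and s\<^sub>1 s\<^sub>2 :: nat
  assumes "\<forall>\<phi>\<in>C. identifies \<phi> s\<^sub>1 s\<^sub>2 A"
  shows "\<exists>M :: 'v inference_algorithm. sound M \<and>
    (\<forall>T k\<^sub>1 k\<^sub>2.
       standing_assumptions T \<and>
       (\<exists>I\<in>C. inductive_invariant T I \<and> forwards_fenced T k\<^sub>1 I \<and> backwards_fenced T k\<^sub>2 I)
       \<longrightarrow> finds_invariant M T k\<^sub>1 k\<^sub>2 (s\<^sub>1 + 1)
             (CARD('v) * (s\<^sub>1 + s\<^sub>2)) (CARD('v) * (s\<^sub>1 + s\<^sub>2)))"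
proof -
  \<comment> \<open>The length of \<open>vs\<close> is the cost of one query; since
    \<open>vs\<close> contains every variable, the walk may start at any state.\<close>
  obtain vs :: "'v list" where vs: "set vs = UNIV" "length vs = CARD('v)"
    by (metis finite_distinct_list distinct_card finite)
  \<comment> \<open>One unit of fuel per query and one more for the final output. Any initial state
    can serve as the end of the walk.\<close>
  define M :: "'v inference_algorithm" where
    "M = (\<lambda>S B k\<^sub>1 k\<^sub>2. infer (member_along k\<^sub>1 k\<^sub>2 (SOME \<tau>. \<tau> \<in> S) vs) (Suc (s\<^sub>1 + s\<^sub>2)) A)"
  have "sound M"
    unfolding sound_def M_def by (metis run_infer_sound run_member_along)
  moreover have "finds_invariant M T k\<^sub>1 k\<^sub>2 (s\<^sub>1 + 1)
      (CARD('v) * (s\<^sub>1 + s\<^sub>2)) (CARD('v) * (s\<^sub>1 + s\<^sub>2))"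
    if T: "standing_assumptions T" and I: "I \<in> C" "inductive_invariant T I"
      "forwards_fenced T k\<^sub>1 I" "backwards_fenced T k\<^sub>2 I" for T k\<^sub>1 k\<^sub>2 I
  proof -
    have \<tau>: "(SOME \<tau>. \<tau> \<in> Init T) \<in> Init T"
      using T by (auto simp: standing_assumptions_def some_in_eq)
    have Q: "\<exists>b' d. run T (K (\<sigma> \<in> I)) c b' r \<and> b = b' + d \<and>
        d \<subseteq># replicate_mset CARD('v) k\<^sub>1 + replicate_mset CARD('v) k\<^sub>2"
      if "run T (member_along k\<^sub>1 k\<^sub>2 (SOME \<tau>. \<tau> \<in> Init T) vs \<sigma> K) c b r" for \<sigma> K c b r
      using run_member_along_fenced[OF I(2-4) \<tau> _ that] vs by simp
    have ident: "identifies I s\<^sub>1 s\<^sub>2 A" using assms I(1) by blast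
    show ?thesis
      unfolding finds_invariant_def M_def
      by (intro allI impI, rule run_infer_identifies[OF I(2) _ ident lessI], rule Q)
  qed
  ultimately show ?thesis by blast
qed

end
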